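(* Let $n$ be a positive integer. For every $j\in\mathbb{Z}$ the operator $S_{n,j}$ preserves $e_0$, i.e. $S_{n,j}e_0=e_0$ on $[0,\infty)$; and for every integer $j\geq 1$ it also preserves $e_j$, i.e. $(S_{n,j}e_j)(x)=x^j$ for all $x\ge 0$.
   Context: For $\ell=0,1,\ldots$, $e_\ell(t)=t^\ell$, $t\ge 0$. Put $s_{n,k}(x)=\frac{(nx)^k}{k!}e^{-nx}$ for integers $k\ge 0$ and $s_{n,k}(x)=0$ for $k<0$ (with $0^0=1$). For $j\in\mathbb{Z}$, a locally integrable function $f:[0,\infty)\to\mathbb{R}$ with $|f(t)|\le Ke^{At}$ for all $t\ge0$ (for some constants $K>0$, $A\ge0$) and positive integers $n>A$, the operator $S_{n,j}$ is defined for $x\ge0$ by $$(S_{n,j}f)(x)=f(0)\sum_{k=0}^{j-1}s_{n,k}(x)+\sum_{k=j}^{\infty}s_{n,k}(x)\,n\int_0^\infty s_{n,k-j}(t)f(t)\,dt.$$ A sum is zero if its upper limit is smaller than its lower limit. *)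

theory Defs
  imports "HOL-Analysis.Analysis"
begin

definition e :: "nat \<Rightarrow> real \<Rightarrow> real"
  where "e l t = t ^ l"

definition s :: "nat \<Rightarrow> int \<Rightarrow> real \<Rightarrow> real"
  where "s n k x =
    (if k < 0 then 0 else (real n * x) ^ nat k / fact (nat k) * exp (- (real n * x)))"

(* The functions S n j is meant for: locally (Lebesgue) integrable on [0,\<infinity>), of
   exponential order A < n. A function on [0,\<infinity>) is represented by a function on the reals;
   only its values on [0,\<infinity>) matter. *)
definition admissible :: "nat \<Rightarrow> (real \<Rightarrow> real) \<Rightarrow> bool"
  where "admissible n f \<longleftrightarrow>
    (\<forall>b\<ge>0. f absolutely_integrable_on {0..b}) \<and>
    (\<exists>K>0. \<exists>A\<ge>0. A < real n \<and> (\<forall>t\<ge>0. \<bar>f t\<bar> \<le> K * exp (A * t)))"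

(* The series over the integers k \<ge> j is indexed by k = j + int i. *)
definition S :: "nat \<Rightarrow> int \<Rightarrow> (real \<Rightarrow> real) \<Rightarrow> real \<Rightarrow> real"
  where "S n j f x =
    f 0 * (\<Sum>k=0..j-1. s n k x) +
    (\<Sum>i. let k = j + int i in
       s n k x * (real n * (LINT t:{0..}|lebesgue. s n (k - j) t * f t)))"

(* The operators are applied to e l within their domain. *)
lemma admissible_e:
  assumes "n > 0"
  shows "admissible n (e l)"
proof -
  have "\<forall>b\<ge>0. e l absolutely_integrable_on {0..b}"
    unfolding e_def
    by (intro allI impI absolutely_integrable_continuous_real continuous_intros)
  moreover have "\<bar>e l t\<bar> \<le> max 1 ((2 * real l) ^ l) * exp (1/2 * t)" if "t \<ge> 0" for t
  proof (cases "l = 0")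
    case True
    then show ?thesis using that by (simp add: e_def)
  next
    case False
    then have "(t / (2 * real l)) ^ l \<le> (1 + (t/2) / real l) ^ l"
      using that by (intro power_mono) auto
    also have "\<dots> \<le> exp (t/2)"
      using that False by (intro exp_ge_one_plus_x_over_n_power_n) auto
    finally have "t ^ l \<le> (2 * real l) ^ l * exp (t/2)"
      using False by (simp add: power_divide field_simps)
    also have "\<dots> \<le> max 1 ((2 * real l) ^ l) * exp (t/2)"
      by (intro mult_right_mono) auto
    finally show ?thesis using that by (simp add: e_def)
  qed
  ultimately show ?thesis
    unfolding admissible_def using assms
    by (intro conjI exI[of _ "max 1 ((2 * real l) ^ l)"] exI[of _ "1/2"]) auto
qed

end

theory Submission
  imports Defs "HOL-Probability.Distributions"
begin

text \<open>
  Everything reduces to the moments of the gamma (Erlang) density. For $m \ge 0$ the kernel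
  $n\,s_{n,m}$ is the Erlang density of shape $m + 1$ and rate $n$, so its $l$-th moment is
  $(m+l)!/(m!\,n^l)$ (lemma \<open>LINT_s_mult_e\<close>). In the series for $S_{n,j} e_l$ the moment that
  multiplies $s_{n,k}(x)$ is the one with $m = k - j$.

  For $l = 0$ each moment is $1$, and together with the finite sum, which carries the factor
  $e_0(0) = 1$, the operator returns the total Poisson mass $\sum_{k \ge 0} s_{n,k}(x) = 1$, for
  either sign of $j$ (lemma \<open>suminf_s_shift\<close>).

  For $l = j \ge 1$ the finite sum carries the factor $e_j(0) = 0$, and the moment is
  $k!/((k-j)!\,n^j)$. Its numerator cancels the factorial of $s_{n,k}(x)$, so that each term is
  $x^j s_{n,k-j}(x)$ (lemma \<open>s_mult_moment\<close>), and the Poisson mass again sums to $1$.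
\<close>

lemma s_of_nat: "s n (int k) x = (real n * x) ^ k / fact k * exp (- (real n * x))"
  by (simp add: s_def)

lemma s_sums_1: "(\<lambda>k. s n (int k) x) sums 1"
proof -
  have "(\<lambda>k. (real n * x) ^ k /\<^sub>R fact k * exp (- (real n * x)))
      sums (exp (real n * x) * exp (- (real n * x)))"
    by (intro sums_mult2 exp_converges)
  then show ?thesis
    by (simp add: s_of_nat divide_inverse mult_ac flip: exp_add)
qed

lemma LINT_s_mult_e:
  assumes "n > 0"
  shows "real n * (LINT t:{0..}|lebesgue. s n (int m) t * e l t)
       = fact (m + l) / (fact m * real n ^ l)"
proof -
  let ?f = "\<lambda>t. erlang_density m (real n) t * t ^ l"
  \<comment> \<open>The density vanishes on the negative axis, which absorbs the restriction to \<open>{0..}\<close>.\<close>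
  have "indicat_real {0..} t *\<^sub>R (s n (int m) t * e l t) = ?f t / real n" for t
    using assms
    by (auto simp: indicator_def erlang_density_def s_of_nat e_def power_mult_distrib field_simps)
  then have "(LINT t:{0..}|lebesgue. s n (int m) t * e l t) = (LINT t|lebesgue. ?f t / real n)"
    unfolding set_lebesgue_integral_def by (rule Bochner_Integration.integral_cong[OF refl])
  also have "\<dots> = (LINT t|lborel. ?f t / real n)"
    by (rule integral_completion) measurable
  also have "\<dots> = (LINT t|lborel. ?f t) / real n"
    by simp
  also have "(LINT t|lborel. ?f t) = fact (m + l) / (fact m * real n ^ l)"
  proof (rule has_bochner_integral_integral_eq, rule has_bochner_integral_nn_integral)
    show "AE t in lborel. 0 \<le> ?f t"
      using assms by (auto simp: erlang_density_def)
    show "(\<integral>\<^sup>+ t. ennreal (?f t) \<partial>lborel) = ennreal (fact (m + l) / (fact m * real n ^ l))"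
      using assms by (simp add: nn_integral_erlang_ith_moment)
  qed simp_all
  finally show ?thesis
    using assms by simp
qed

lemma S_e_eq:
  assumes "n > 0"
  shows "S n j (e l) x = e l 0 * (\<Sum>k=0..j-1. s n k x)
       + (\<Sum>i. s n (j + int i) x * (fact (i + l) / (fact i * real n ^ l)))"
  using LINT_s_mult_e[OF assms] by (simp add: S_def Let_def)

text \<open>
  Both sides of the operator's split at \<open>j\<close> together carry the whole Poisson mass: for \<open>j \<ge> 0\<close>
  the finite sum is the initial segment missing from the series, while for \<open>j < 0\<close> it is empty
  and the series only gains terms of negative index, which are zero by convention.
\<close>

lemma suminf_s_shift:
  "(\<Sum>k=0..j-1. s n k x) + (\<Sum>i. s n (j + int i) x) = 1"
proof (cases "j \<ge> 0")
  case True
  then obtain m where j: "j = int m"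
    using nonneg_int_cases by blast
  have "(\<Sum>k=0..j-1. s n k x) = (\<Sum>k<m. s n (int k) x)"
    by (rule sum.reindex_bij_witness[of _ int nat]) (auto simp: j)
  moreover have "(\<Sum>k. s n (int k) x) = (\<Sum>i. s n (int (i + m)) x) + (\<Sum>k<m. s n (int k) x)"
    by (rule suminf_split_initial_segment) (rule sums_summable[OF s_sums_1])
  ultimately show ?thesis
    using s_sums_1[of n x, THEN sums_unique] by (simp add: j add.commute)
next
  case False
  define m where "m = nat (- j)"
  have "(\<lambda>i. s n (j + int (i + m)) x) sums 1"
    using s_sums_1[of n x] False by (simp add: m_def)
  moreover have "s n (j + int i) x = 0" if "i < m" for i
    using that False by (simp add: s_def m_def)
  ultimately have "(\<lambda>i. s n (j + int i) x) sums 1"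
    by (subst (asm) sums_iff_shift) simp
  then show ?thesis
    using False by (simp add: sums_unique[symmetric])
qed

lemma s_mult_moment:
  assumes "n > 0"
  shows "s n (int j + int i) x * (fact (i + j) / (fact i * real n ^ j)) = x ^ j * s n (int i) x"
proof -
  have "s n (int j + int i) x = (real n * x) ^ (i + j) / fact (i + j) * exp (- (real n * x))"
    using s_of_nat[of n "i + j" x] by (simp add: add.commute)
  then show ?thesis
    using assms by (simp add: s_of_nat power_add power_mult_distrib)
qed

theorem mainTheorem5:
  fixes n :: nat
  assumes "n > 0"
  shows "(\<forall>j::int. \<forall>x\<ge>0. S n j (e 0) x = e 0 x) \<and>
         (\<forall>j::nat. j \<ge> 1 \<longrightarrow> (\<forall>x\<ge>0. S n (int j) (e j) x = x ^ j))"
proof (intro conjI allI impI)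
  fix j :: int and x :: real
  show "S n j (e 0) x = e 0 x"
    using suminf_s_shift[of n x j] by (simp add: S_e_eq[OF assms]) (simp add: e_def)
next
  fix j :: nat and x :: real
  assume "j \<ge> 1"
  then have "S n (int j) (e j) x = (\<Sum>i. x ^ j * s n (int i) x)"
    unfolding S_e_eq[OF assms] s_mult_moment[OF assms] by (simp add: e_def)
  also have "\<dots> = x ^ j"
    using sums_mult[OF s_sums_1, of "x ^ j" n x] by (simp add: sums_unique[symmetric])
  finally show "S n (int j) (e j) x = x ^ j" .
qed

end
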